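(* Let $n\ge1$ be an integer, $s\in\mathbb C$, $\lambda\in\{1,-1\}$. Let $$\widetilde T_n=\sum A,$$ where the sum runs over all matrices $A=\begin{pmatrix}a&b\\c&d\end{pmatrix}\in S_n$ with $\gcd(a,b,c,d)=1$. Let $\phi$ be holomorphic on $\mathbb C\setminus(-\infty,0]$ and satisfy $$\phi(z)=\phi(z+1)+\lambda z^{-2s}\phi\!\left(1+\tfrac1z\right)\quad\text{on }\mathbb C\setminus(-\infty,0].$$ Then $\widetilde\phi:=\phi|_s\widetilde T_n$ is holomorphic on $\mathbb C\setminus(-\infty,0]$ and satisfies the same equation with the same $s$ and $\lambda$.
   Context: $S_n=\{\begin{pmatrix}a&b\\c&d\end{pmatrix}\in\mathbb Z^{2\times2}: a>c\ge0,\ d>b\ge0,\ ad-bc=n\}$. Powers are $z^w=e^{w\log z}$ with the principal logarithm on $\mathbb C\setminus(-\infty,0]$. Slash action: for $R=\begin{pmatrix}a&b\\c&d\end{pmatrix}$ with nonzero determinant, $$(\phi|_sR)(z)=|\det R|^s(cz+d)^{-2s}\phi\!\left(\tfrac{az+b}{cz+d}\right),$$ extended linearly to formal $\mathbb Z$-linear combinations of matrices. *)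

theory Defs
  imports "HOL-Complex_Analysis.Complex_Analysis" "HOL-Library.Poly_Mapping"
begin

text \<open>Reserve the dollar notation for matrix entries; it also denotes power series coefficients.\<close>

no_notation fps_nth (infixl \<open>$\<close> 75)

abbreviation slit_plane :: "complex set" where
  "slit_plane \<equiv> - \<real>\<^sub>\<le>\<^sub>0"

definition S :: "int \<Rightarrow> (int^2^2) set" where
  "S n = {A. A$1$1 > A$2$1 \<and> A$2$1 \<ge> 0 \<and> A$2$2 > A$1$2 \<and> A$1$2 \<ge> 0 \<and>
             A$1$1 * A$2$2 - A$1$2 * A$2$1 = n}"

text \<open>The slash action \<open>\<phi>|\<^sub>sR\<close> of a single matrix with nonzero determinant.  Off the slit plane
  \<open>powr\<close> still has a value (with \<open>0 powr w = 0\<close> and \<open>Ln\<close> extended to the negative axis);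
  for \<open>R \<in> S n\<close>, \<open>n \<ge> 1\<close> and \<open>z\<close> in the slit plane, both \<open>cz + d\<close> and \<open>(az + b)/(cz + d)\<close>
  lie in the slit plane, so these values play no role.\<close>

definition slash1 :: "complex \<Rightarrow> (complex \<Rightarrow> complex) \<Rightarrow> int^2^2 \<Rightarrow> complex \<Rightarrow> complex" where
  "slash1 s \<phi> R z =
     of_int \<bar>det R\<bar> powr s * (of_int (R$2$1) * z + of_int (R$2$2)) powr (- 2 * s) *
     \<phi> ((of_int (R$1$1) * z + of_int (R$1$2)) / (of_int (R$2$1) * z + of_int (R$2$2)))"

text \<open>Formal \<open>\<int>\<close>-linear combinations of matrices are finitely supported functions to \<open>int\<close>.\<close>

definition slash ::
    "complex \<Rightarrow> (complex \<Rightarrow> complex) \<Rightarrow> ((int^2^2) \<Rightarrow>\<^sub>0 int) \<Rightarrow> complex \<Rightarrow> complex" where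
  "slash s \<phi> T z = (\<Sum>R\<in>Poly_Mapping.keys T. of_int (Poly_Mapping.lookup T R) * slash1 s \<phi> R z)"

text \<open>The index set is finite: \<open>n = ad - bc \<ge> ad - (a - 1)(d - 1) = a + d - 1\<close> on \<open>S n\<close>.\<close>

definition T_prim :: "int \<Rightarrow> ((int^2^2) \<Rightarrow>\<^sub>0 int)" where
  "T_prim n = (\<Sum>A\<in>{A \<in> S n. Gcd {A$1$1, A$1$2, A$2$1, A$2$2} = 1}. frag_of A)"

definition three_term_eq :: "complex \<Rightarrow> complex \<Rightarrow> (complex \<Rightarrow> complex) \<Rightarrow> bool" where
  "three_term_eq s lam \<phi> \<longleftrightarrow>
     (\<forall>z\<in>slit_plane. \<phi> z = \<phi> (z + 1) + lam * z powr (- 2 * s) * \<phi> (1 + 1 / z))"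

end

theory Submission
  imports Defs
begin

text \<open>The equation says exactly that \<phi>|J = \<lambda> \<phi> for J = (0 1; 1 0), and that
  \<phi> = \<phi>|T + \<phi>|T' for T = (1 1; 0 1) and T' = (1 0; 1 1).  Conjugation by J permutes the
  primitive matrices in S_n, which gives the first identity for the sum.  For the second, let
  A = (a b; c d) run over the primitive part R of S_n.  If a + b < c + d then AT is again in R;
  otherwise AT = TX with X in the set R' of transposes of elements of R.  Similarly AT' is in R or
  equals T'X with X in R'.  Hence the sum over R of A - AT - AT' is the sum over the
  intersection of R and R' minus terms TX and T'X; summing X = TX + T'X over R' shows that these
  terms add up to the sum over the same intersection.\<close>

section \<open>Sums over reduced matrices\<close>

text \<open>The splitting of \<open>f\<close> adds rows, whereas the conclusion adds columns; the
  transposed set \<open>R'\<close> mediates between the two. Only invariance of \<open>Q\<close>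
  under elementary row and column additions, finiteness and the splitting enter, so the argument is
  pure bookkeeping in an abelian group.\<close>

lemma sum_reduced_eq:
  fixes f :: "int \<Rightarrow> int \<Rightarrow> int \<Rightarrow> int \<Rightarrow> 'a::ab_group_add"
    and Q :: "int \<Rightarrow> int \<Rightarrow> int \<Rightarrow> int \<Rightarrow> bool"
  assumes col1: "\<And>a b c d. Q a (a + b) c (c + d) \<longleftrightarrow> Q a b c d"
    and col2: "\<And>a b c d. Q (a + b) b (c + d) d \<longleftrightarrow> Q a b c d"
    and row1: "\<And>a b c d. Q (a + c) (b + d) c d \<longleftrightarrow> Q a b c d"
    and row2: "\<And>a b c d. Q a b (a + c) (b + d) \<longleftrightarrow> Q a b c d"
    and fin: "finite {(a, b, c, d). Q a b c d \<and> a > c \<and> c \<ge> 0 \<and> d > b \<and> b \<ge> 0}"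
    and fin': "finite {(a, b, c, d). Q a b c d \<and> a > b \<and> b \<ge> 0 \<and> d > c \<and> c \<ge> 0}"
    and f: "\<And>a b c d. Q a b c d \<Longrightarrow> a \<ge> 0 \<Longrightarrow> b \<ge> 0 \<Longrightarrow> c \<ge> 0 \<Longrightarrow> d \<ge> 0 \<Longrightarrow>
              f a b c d = f (a + c) (b + d) c d + f a b (a + c) (b + d)"
  defines "R \<equiv> {(a, b, c, d). Q a b c d \<and> a > c \<and> c \<ge> 0 \<and> d > b \<and> b \<ge> 0}"
  shows "(\<Sum>(a, b, c, d)\<in>R. f a b c d) =
         (\<Sum>(a, b, c, d)\<in>R. f a (a + b) c (c + d)) + (\<Sum>(a, b, c, d)\<in>R. f (a + b) b (c + d) d)"
proof -
  define R' where "R' = {(a, b, c, d). Q a b c d \<and> a > b \<and> b \<ge> 0 \<and> d > c \<and> c \<ge> 0}"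
  define F where "F = (\<lambda>(a, b, c, d). f a b c d)"
  define F1 where "F1 = (\<lambda>(a, b, c, d). f a (a + b) c (c + d))"
  define F2 where "F2 = (\<lambda>(a, b, c, d). f (a + b) b (c + d) d)"
  define G1 where "G1 = (\<lambda>(a, b, c, d). f (a + c) (b + d) c d)"
  define G2 where "G2 = (\<lambda>(a, b, c, d). f a b (a + c) (b + d))"
  note defs = F_def F1_def F2_def G1_def G2_def R_def R'_def
  \<comment> \<open>The bijections below have to be undone, so invariance is also needed for the
    inverse transvections.\<close>
  have col1': "Q a (b - a) c (d - c) \<longleftrightarrow> Q a b c d" for a b c d
    using col1[of a "b - a" c "d - c"] by simp
  have col2': "Q (a - b) b (c - d) d \<longleftrightarrow> Q a b c d" for a b c d
    using col2[of "a - b" b "c - d" d] by simp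
  have row1': "Q (a - c) (b - d) c d \<longleftrightarrow> Q a b c d" for a b c d
    using row1[of "a - c" c "b - d" d] by simp
  have row2': "Q a b (c - a) (d - b) \<longleftrightarrow> Q a b c d" for a b c d
    using row2[of a b "c - a" "d - b"] by simp
  note Q_simps = col1 col2 row1 row2 col1' col2' row1' row2'
  have finR: "finite R" and finR': "finite R'"
    using fin fin' by (simp_all add: R_def R'_def)
  \<comment> \<open>\<open>L1\<close>, \<open>L2\<close> hold the matrices that stay in
    \<open>R\<close> after a column addition, \<open>B1\<close>, \<open>B2\<close> the resulting
    matrices, and \<open>M1\<close>, \<open>M2\<close> the complements of \<open>L1\<close>,
    \<open>L2\<close>. The primed sets do the same for row additions in \<open>R'\<close>. A tie
    \<open>a + b = c + d\<close> lies in both \<open>M1\<close> and \<open>M2\<close>, since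
    reducedness is strict.\<close>
  define B1 where "B1 = {(a, b, c, d)\<in>R. b \<ge> a}"
  define B2 where "B2 = {(a, b, c, d)\<in>R. c \<ge> d}"
  define L1 where "L1 = {(a, b, c, d)\<in>R. a + b < c + d}"
  define L2 where "L2 = {(a, b, c, d)\<in>R. a + b > c + d}"
  define M1 where "M1 = {(a, b, c, d)\<in>R. a + b \<ge> c + d}"
  define M2 where "M2 = {(a, b, c, d)\<in>R. a + b \<le> c + d}"
  define B1' where "B1' = {(a, b, c, d)\<in>R'. b \<ge> d}"
  define B2' where "B2' = {(a, b, c, d)\<in>R'. c \<ge> a}"
  define L1' where "L1' = {(a, b, c, d)\<in>R'. a + c > b + d}"
  define L2' where "L2' = {(a, b, c, d)\<in>R'. a + c < b + d}"
  define M1' where "M1' = {(a, b, c, d)\<in>R'. a + c \<le> b + d}"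
  define M2' where "M2' = {(a, b, c, d)\<in>R'. a + c \<ge> b + d}"
  note sets = B1_def B2_def L1_def L2_def M1_def M2_def
    B1'_def B2'_def L1'_def L2'_def M1'_def M2'_def
  have fins: "finite B1" "finite B2" "finite L1" "finite L2" "finite M1" "finite M2" "finite (R \<inter> R')"
    "finite B1'" "finite B2'" "finite L1'" "finite L2'" "finite M1'" "finite M2'"
    using finR finR' by (auto simp: sets intro: finite_subset)

  have split3: "sum F X = sum F Y + sum F Z + sum F W"
    if "X = Y \<union> Z \<union> W" "finite Y" "finite Z" "finite W" "Y \<inter> Z = {}" "(Y \<union> Z) \<inter> W = {}" for X Y Z W
    unfolding that(1) by (simp only: sum.union_disjoint[OF _ that(4) that(6)]
        sum.union_disjoint[OF that(2,3,5)] finite_UnI[OF that(2,3)])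
  have split2: "sum h X = sum h Y + sum h Z"
    if "X = Y \<union> Z" "finite Y" "finite Z" "Y \<inter> Z = {}" for X Y Z and h :: "_ \<Rightarrow> 'a"
    unfolding that(1) by (rule sum.union_disjoint[OF that(2-4)])

  \<comment> \<open>An element of \<open>R\<close> outside \<open>R'\<close> has
    \<open>b \<ge> a\<close> or \<open>c \<ge> d\<close>. Both at once would give
    \<open>d > b \<ge> a > c \<ge> d\<close>.\<close>
  have "sum F R = sum F (R \<inter> R') + sum F B1 + sum F B2"
    by (rule split3) (use fins in \<open>auto simp: defs sets\<close>)
  moreover have "sum F1 R = sum F1 L1 + sum F1 M1"
    by (rule split2) (use fins in \<open>auto simp: sets\<close>)
  moreover have "sum F2 R = sum F2 L2 + sum F2 M2"
    by (rule split2) (use fins in \<open>auto simp: sets\<close>)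
  moreover have "sum F1 L1 = sum F B1"
    by (rule sum.reindex_bij_witness[where j = "\<lambda>(a, b, c, d). (a, a + b, c, c + d)"
          and i = "\<lambda>(a, b, c, d). (a, b - a, c, d - c)"]) (auto simp: defs sets Q_simps)
  moreover have "sum F2 L2 = sum F B2"
    by (rule sum.reindex_bij_witness[where j = "\<lambda>(a, b, c, d). (a + b, b, c + d, d)"
          and i = "\<lambda>(a, b, c, d). (a - b, b, c - d, d)"]) (auto simp: defs sets Q_simps)
  \<comment> \<open>The witness is X = T^(-1) A T: after the column addition, the second row is
    subtracted from the first. The inequality defining \<open>M1\<close> makes the upper right entry
    of X nonnegative.\<close>
  moreover have "sum F1 M1 = sum G1 M1'"
  proof (rule sum.reindex_bij_witness[where j = "\<lambda>(a, b, c, d). (a - c, a + b - (c + d), c, c + d)"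
          and i = "\<lambda>(a, b, c, d). (a + c, b + d - (a + c), c, d - c)"])
  qed (auto simp: defs sets Q_simps)
  moreover have "sum F2 M2 = sum G2 M2'"
  proof (rule sum.reindex_bij_witness[where j = "\<lambda>(a, b, c, d). (a + b, b, c + d - (a + b), d - b)"
          and i = "\<lambda>(a, b, c, d). (a - b, b, a + c - (b + d), b + d)"])
  qed (auto simp: defs sets Q_simps)
  moreover have "sum F R' = sum F (R \<inter> R') + sum F B1' + sum F B2'"
    by (rule split3) (use fins in \<open>auto simp: defs sets\<close>)
  moreover have "sum F R' = sum G1 R' + sum G2 R'"
    unfolding sum.distrib[symmetric] by (rule sum.cong) (auto simp: defs intro!: f)
  moreover have "sum G1 R' = sum G1 L1' + sum G1 M1'"
    by (rule split2) (use fins in \<open>auto simp: sets\<close>)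
  moreover have "sum G2 R' = sum G2 L2' + sum G2 M2'"
    by (rule split2) (use fins in \<open>auto simp: sets\<close>)
  moreover have "sum G1 L1' = sum F B1'"
    by (rule sum.reindex_bij_witness[where j = "\<lambda>(a, b, c, d). (a + c, b + d, c, d)"
          and i = "\<lambda>(a, b, c, d). (a - c, b - d, c, d)"]) (auto simp: defs sets Q_simps)
  moreover have "sum G2 L2' = sum F B2'"
    by (rule sum.reindex_bij_witness[where j = "\<lambda>(a, b, c, d). (a, b, a + c, b + d)"
          and i = "\<lambda>(a, b, c, d). (a, b, c - a, d - b)"]) (auto simp: defs sets Q_simps)
  \<comment> \<open>The identities over \<open>R\<close> reduce the claim to
    \<open>sum F (R \<inter> R') = sum G1 M1' + sum G2 M2'\<close>, which is what the two
    evaluations of \<open>sum F R'\<close> give.\<close>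
  ultimately have "sum F R = sum F1 R + sum F2 R"
    by (simp add: algebra_simps)
  then show ?thesis
    by (simp add: F_def F1_def F2_def)
qed

section \<open>The homogeneous form of the three-term equation\<close>

lemma mem_slit_plane_iff: "z \<in> slit_plane \<longleftrightarrow> Im z \<noteq> 0 \<or> Re z > 0"
  by (auto simp: complex_nonpos_Reals_iff)

lemma nonneg_combination_in_slit_plane:
  assumes "z \<in> slit_plane" "a \<ge> 0" "b \<ge> 0" "a \<noteq> 0 \<or> b \<noteq> 0"
  shows "of_int a * z + of_int b \<in> slit_plane"
  using assms unfolding mem_slit_plane_iff by (auto simp: add_pos_nonneg add_nonneg_pos)

text \<open>The sign condition puts both points in one closed half-plane, upper or lower. This keeps
  quotients off the cut and makes powers of quotients split.\<close>

definition same_side :: "complex \<Rightarrow> complex \<Rightarrow> bool" where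
  "same_side u v \<longleftrightarrow> u \<in> slit_plane \<and> v \<in> slit_plane \<and> Im u * Im v \<ge> 0"

lemma same_side_commute: "same_side u v \<longleftrightarrow> same_side v u"
  by (auto simp: same_side_def mult.commute)

lemma same_side_nonneg_combination:
  assumes "z \<in> slit_plane" "a \<ge> 0" "b \<ge> 0" "c \<ge> 0" "d \<ge> 0"
    and "a \<noteq> 0 \<or> b \<noteq> 0" "c \<noteq> 0 \<or> d \<noteq> 0"
  shows "same_side (of_int a * z + of_int b) (of_int c * z + of_int d)"
proof -
  have "0 \<le> of_int (a * c) * (Im z)\<^sup>2"
    using assms by simp
  also have "\<dots> = Im (of_int a * z) * Im (of_int c * z)"
    by (simp add: power2_eq_square)
  finally have "Im (of_int a * z) * Im (of_int c * z) \<ge> 0" .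
  then show ?thesis
    using assms by (simp add: same_side_def nonneg_combination_in_slit_plane del: Compl_iff)
qed

text \<open>A closed upper or lower half-plane without the nonpositive reals is closed under
  addition.\<close>

lemma same_side_add:
  assumes "same_side u v"
  shows "same_side (u + v) v"
proof -
  have "Im u + Im v \<noteq> 0 \<or> Re u + Re v > 0" if "Im u \<ge> 0 \<and> Im v \<ge> 0 \<or> Im u \<le> 0 \<and> Im v \<le> 0"
    using assms that by (auto simp: same_side_def mem_slit_plane_iff simp del: Compl_iff)
  then show ?thesis
    using assms
    by (auto simp: same_side_def mem_slit_plane_iff zero_le_mult_iff algebra_simps simp del: Compl_iff)
qed

text \<open>The two arguments lie both in [0, pi) or both in (-pi, 0], so their difference stays
  within the principal range and no multiple of 2 pi i appears.\<close>

lemma Ln_divide_same_side: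
  assumes "same_side u v"
  shows "Ln (u / v) = Ln u - Ln v"
proof (rule Ln_unique)
  have nz: "u \<noteq> 0" "v \<noteq> 0" using assms by (auto simp: same_side_def)
  then show "exp (Ln u - Ln v) = u / v" by (simp add: exp_diff)
  have lt: "\<bar>Im (Ln w)\<bar> < pi" if "w \<in> slit_plane" for w
    using that mpi_less_Im_Ln[of w] Im_Ln_less_pi[of w] by (cases "w = 0") (auto simp: abs_less_iff)
  have pos: "Im (Ln w) \<ge> 0" if "w \<in> slit_plane" "Im w \<ge> 0" for w
    using that lt[of w] Im_Ln_pos_le[of w] by (cases "w = 0") auto
  have neg: "Im (Ln w) \<le> 0" if "w \<in> slit_plane" "Im w \<le> 0" for w
    using that lt[of w] Im_Ln_pos_lt[of w] by (cases "w = 0") (auto simp: not_less[symmetric])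
  have "\<bar>Im (Ln u - Ln v)\<bar> < pi"
  proof (cases "Im u \<ge> 0 \<and> Im v \<ge> 0")
    case True
    then show ?thesis using pos[of u] pos[of v] lt[of u] lt[of v] assms
      by (auto simp: same_side_def simp del: Compl_iff)
  next
    case False
    then have "Im u \<le> 0 \<and> Im v \<le> 0" 
      using assms by (auto simp: same_side_def zero_le_mult_iff)
    then show ?thesis using neg[of u] neg[of v] lt[of u] lt[of v] assms
      by (auto simp: same_side_def simp del: Compl_iff)
  qed
  then show "- pi < Im (Ln u - Ln v)" "Im (Ln u - Ln v) \<le> pi" by auto
qed

lemma powr_divide_same_side:
  assumes "same_side u v"
  shows "(u / v) powr w = u powr w / v powr w"
proof -
  have "u \<noteq> 0" "v \<noteq> 0" using assms by (auto simp: same_side_def)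
  then show ?thesis
    by (simp add: powr_def Ln_divide_same_side[OF assms] exp_diff right_diff_distrib)
qed

text \<open>If \<open>u = t * v\<close> with \<open>t \<le> 0\<close>, the sign condition forces
  \<open>t = 0\<close> or \<open>v\<close> real; either way \<open>u\<close> would be a nonpositive
  real.\<close>

lemma same_side_divide_in_slit_plane:
  assumes "same_side u v"
  shows "u / v \<in> slit_plane"
proof
  assume "u / v \<in> \<real>\<^sub>\<le>\<^sub>0"
  then obtain t where t: "t \<le> 0" "u / v = of_real t"
    by (auto elim: nonpos_Reals_cases)
  have "v \<noteq> 0" using assms by (auto simp: same_side_def)
  with t have u: "u = of_real t * v" by (simp add: field_simps)
  have "t * (Im v)\<^sup>2 \<ge> 0"
    using assms by (simp add: u same_side_def power2_eq_square mult.assoc)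
  then have "t = 0 \<or> Im v = 0" using t(1) by (auto simp: zero_le_mult_iff)
  then show False
    using assms t(1)
    by (auto simp: u same_side_def mem_slit_plane_iff zero_less_mult_iff simp del: Compl_iff)
qed

text \<open>The extension of \<phi> to two variables, formally homogeneous of degree
  \<open>-2 * s\<close>. Up to the determinant factor, slashing by a matrix becomes a linear
  substitution, so products of matrices need no automorphy factors.\<close>

definition homog :: "complex \<Rightarrow> (complex \<Rightarrow> complex) \<Rightarrow> complex \<Rightarrow> complex \<Rightarrow> complex" where
  "homog s \<phi> u v = v powr (- 2 * s) * \<phi> (u / v)"

lemma homog_divide:
  assumes "same_side v z"
  shows "z powr (- 2 * s) * homog s \<phi> (u / z) (v / z) = homog s \<phi> u v"
proof -
  have "z \<noteq> 0" "v \<noteq> 0" using assms by (auto simp: same_side_def)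
  then show ?thesis
    by (simp add: homog_def powr_divide_same_side[OF assms])
qed

context
  fixes s lam :: complex and \<phi> :: "complex \<Rightarrow> complex"
  assumes lam: "lam \<in> {1, -1}" and eq: "three_term_eq s lam \<phi>"
begin

lemma homog_three_term:
  assumes "same_side u v"
  shows "homog s \<phi> u v = homog s \<phi> (u + v) v + lam * homog s \<phi> (u + v) u"
proof -
  have nz: "u \<noteq> 0" "v \<noteq> 0" using assms by (auto simp: same_side_def)
  have "\<phi> (u / v) = \<phi> (u / v + 1) + lam * (u / v) powr (- 2 * s) * \<phi> (1 + 1 / (u / v))"
    using eq same_side_divide_in_slit_plane[OF assms] unfolding three_term_eq_def by blast
  also have "u / v + 1 = (u + v) / v" using nz by (simp add: field_simps)
  also have "1 + 1 / (u / v) = (u + v) / u" using nz by (simp add: field_simps)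
  finally show ?thesis
    using nz by (simp add: homog_def powr_divide_same_side[OF assms] field_simps)
qed

text \<open>Since \<open>lam * lam = 1\<close>, exchanging \<open>u\<close> and \<open>v\<close>
  multiplies the right-hand side of the three-term relation by \<open>lam\<close>.\<close>

lemma homog_swap:
  assumes "same_side u v"
  shows "lam * homog s \<phi> v u = homog s \<phi> u v"
  using homog_three_term[OF assms] homog_three_term[of v u] assms lam
  by (auto simp: same_side_commute add.commute)

text \<open>The swap absorbs \<open>lam\<close> in the last term. What remains is the row splitting
  required by \<open>sum_reduced_eq\<close>.\<close>

lemma homog_split:
  assumes "same_side u v"
  shows "homog s \<phi> u v = homog s \<phi> (u + v) v + homog s \<phi> u (u + v)"
  using homog_three_term[OF assms] homog_swap[of u "u + v"] same_side_add[of v u] assms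
  by (simp add: same_side_commute add.commute)

end

section \<open>Primitive matrices as quadruples\<close>

definition prim_det :: "int \<Rightarrow> int \<Rightarrow> int \<Rightarrow> int \<Rightarrow> int \<Rightarrow> bool" where
  "prim_det n a b c d \<longleftrightarrow> a * d - b * c = n \<and> Gcd {a, b, c, d} = 1"

lemma Gcd_quadruple_eq_1_iff:
  "Gcd {a, b, c, d :: int} = 1 \<longleftrightarrow> (\<forall>k. k dvd a \<longrightarrow> k dvd b \<longrightarrow> k dvd c \<longrightarrow> k dvd d \<longrightarrow> k dvd 1)"
proof
  assume "Gcd {a, b, c, d} = 1"
  then show "\<forall>k. k dvd a \<longrightarrow> k dvd b \<longrightarrow> k dvd c \<longrightarrow> k dvd d \<longrightarrow> k dvd 1"
    by (metis Gcd_greatest insertE singletonD)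
next
  assume "\<forall>k. k dvd a \<longrightarrow> k dvd b \<longrightarrow> k dvd c \<longrightarrow> k dvd d \<longrightarrow> k dvd 1"
  then have "Gcd {a, b, c, d} dvd 1"
    by (meson Gcd_dvd insertCI)
  then show "Gcd {a, b, c, d} = 1"
    by simp
qed

text \<open>Transvections preserve the determinant and the common divisors of the entries. The order
  of the four claims matches the invariance hypotheses of \<open>sum_reduced_eq\<close>.\<close>

lemma prim_det_transvections:
  "prim_det n a (a + b) c (c + d) \<longleftrightarrow> prim_det n a b c d"
  "prim_det n (a + b) b (c + d) d \<longleftrightarrow> prim_det n a b c d"
  "prim_det n (a + c) (b + d) c d \<longleftrightarrow> prim_det n a b c d"
  "prim_det n a b (a + c) (b + d) \<longleftrightarrow> prim_det n a b c d"
  unfolding prim_det_def Gcd_quadruple_eq_1_iff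
  by (auto simp: algebra_simps dvd_add_right_iff dvd_add_left_iff cong: conj_cong imp_cong)

text \<open>This is conjugation by J, which exchanges both the rows and the columns.\<close>

lemma prim_det_rotate: "prim_det n d c b a \<longleftrightarrow> prim_det n a b c d"
  by (simp add: prim_det_def mult.commute insert_commute)

lemma prim_det_transpose: "prim_det n a c b d \<longleftrightarrow> prim_det n a b c d"
  unfolding prim_det_def Gcd_quadruple_eq_1_iff by (auto simp: mult.commute)

definition reduced_quads :: "int \<Rightarrow> (int \<times> int \<times> int \<times> int) set" where
  "reduced_quads n = {(a, b, c, d). prim_det n a b c d \<and> a > c \<and> c \<ge> 0 \<and> d > b \<and> b \<ge> 0}"

text \<open>For fixed determinant this confines reduced matrices to a finite box.\<close>

lemma entries_bounded:
  fixes a b c d :: int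
  assumes "a > c" "c \<ge> 0" "d > b" "b \<ge> 0"
  shows "a + d \<le> a * d - b * c + 1"
proof -
  have "b * c \<le> (d - 1) * (a - 1)" using assms by (intro mult_mono) auto
  then show ?thesis by (simp add: algebra_simps)
qed

lemma finite_reduced: "finite (reduced_quads n)"
proof (rule finite_subset)
  show "reduced_quads n \<subseteq> {0..n + 1} \<times> {0..n + 1} \<times> {0..n + 1} \<times> {0..n + 1}"
    using entries_bounded by (fastforce simp: reduced_quads_def prim_det_def)
qed auto

lemma finite_reduced_transpose:
  "finite {(a, b, c, d). prim_det n a b c d \<and> a > b \<and> b \<ge> 0 \<and> d > c \<and> c \<ge> 0}" (is "finite ?X")
proof (rule finite_subset)
  have "x \<in> (\<lambda>(a, b, c, d). (a, c, b, d)) ` reduced_quads n" if "x \<in> ?X" for x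
  proof -
    obtain a b c d where "x = (a, b, c, d)" by (cases x)
    then show ?thesis using that
      by (intro image_eqI[of _ _ "(a, c, b, d)"])
        (auto simp: reduced_quads_def prim_det_transpose)
  qed
  then show "?X \<subseteq> (\<lambda>(a, b, c, d). (a, c, b, d)) ` reduced_quads n" by blast
qed (simp add: finite_reduced)

section \<open>From quadruples to matrices and formal sums\<close>

definition matrix_of :: "int \<times> int \<times> int \<times> int \<Rightarrow> int^2^2" where
  "matrix_of = (\<lambda>(a, b, c, d). vector [vector [a, b], vector [c, d]])"

lemma matrix_of_nth [simp]:
  "matrix_of (a, b, c, d) $ 1 $ 1 = a" "matrix_of (a, b, c, d) $ 1 $ 2 = b"
  "matrix_of (a, b, c, d) $ 2 $ 1 = c" "matrix_of (a, b, c, d) $ 2 $ 2 = d"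
  by (simp_all add: matrix_of_def)

lemma inj_matrix_of: "inj matrix_of"
  by (rule injI) (metis matrix_of_nth prod_cases4)

lemma primitive_S_eq: "{A \<in> S n. Gcd {A$1$1, A$1$2, A$2$1, A$2$2} = 1} = matrix_of ` reduced_quads n"
proof (intro equalityI subsetI)
  fix A assume A: "A \<in> {A \<in> S n. Gcd {A$1$1, A$1$2, A$2$1, A$2$2} = 1}"
  have "A = matrix_of (A$1$1, A$1$2, A$2$1, A$2$2)"
    by (simp add: vec_eq_iff forall_2)
  moreover have "(A$1$1, A$1$2, A$2$1, A$2$2) \<in> reduced_quads n"
    using A by (auto simp: S_def reduced_quads_def prim_det_def)
  ultimately show "A \<in> matrix_of ` reduced_quads n" by blast
qed (auto simp: S_def reduced_quads_def prim_det_def)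

lemma lookup_sum_frag_of:
  assumes "finite X"
  shows "Poly_Mapping.lookup (\<Sum>A\<in>X. frag_of A) R = (if R \<in> X then 1 else 0)"
  using assms by (simp add: lookup_sum lookup_single when_def)

text \<open>All coefficients are 1 and all determinants equal \<open>n\<close>, so one constant
  comes out of the sum; the three-term equation, being linear, is then a statement about the sum of
  \<open>homog\<close> alone.\<close>

lemma slash_T_prim:
  assumes "n \<ge> 1"
  shows "slash s \<phi> (T_prim n) z = of_int n powr s *
           (\<Sum>(a, b, c, d)\<in>reduced_quads n.
              homog s \<phi> (of_int a * z + of_int b) (of_int c * z + of_int d))"
proof -
  let ?X = "matrix_of ` reduced_quads n"
  have fin: "finite ?X" by (simp add: finite_reduced)
  have look: "Poly_Mapping.lookup (T_prim n) R = (if R \<in> ?X then 1 else 0)" for R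
    unfolding T_prim_def primitive_S_eq by (rule lookup_sum_frag_of[OF fin])
  have "Poly_Mapping.keys (T_prim n) = ?X"
    by (auto simp: in_keys_iff look split: if_splits)
  then have "slash s \<phi> (T_prim n) z = (\<Sum>R\<in>?X. slash1 s \<phi> R z)"
    by (simp add: slash_def look)
  also have "\<dots> = (\<Sum>x\<in>reduced_quads n. slash1 s \<phi> (matrix_of x) z)"
    using inj_matrix_of by (subst sum.reindex) (auto intro: inj_on_subset)
  also have "\<dots> = (\<Sum>(a, b, c, d)\<in>reduced_quads n. of_int n powr s *
              homog s \<phi> (of_int a * z + of_int b) (of_int c * z + of_int d))"
    using assms by (intro sum.cong)
      (auto simp: slash1_def homog_def det_2 reduced_quads_def prim_det_def mult.assoc)
  finally show ?thesis
    by (simp add: sum_distrib_left case_prod_unfold)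
qed

lemma holomorphic_homog_linear:
  assumes "\<phi> holomorphic_on slit_plane"
    and "a \<ge> 0" "b \<ge> 0" "c \<ge> 0" "d \<ge> 0" "a * d - b * c \<noteq> 0"
  shows "(\<lambda>z. homog s \<phi> (of_int a * z + of_int b) (of_int c * z + of_int d))
           holomorphic_on slit_plane"
proof -
  \<comment> \<open>The nonzero determinant excludes a vanishing row.\<close>
  have side: "same_side (of_int a * z + of_int b) (of_int c * z + of_int d)" if "z \<in> slit_plane" for z
    using assms(2-) by (intro same_side_nonneg_combination that) auto
  have slit: "of_int c * z + of_int d \<in> slit_plane" if "z \<in> slit_plane" for z
    using side[OF that] by (simp add: same_side_def)
  then have nz: "of_int c * z + of_int d \<noteq> (0::complex)" if "z \<in> slit_plane" for z
    using that by force
  have "(\<lambda>z. (of_int a * z + of_int b) / (of_int c * z + of_int d)) holomorphic_on slit_plane"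
    by (intro holomorphic_intros nz)
  then have "(\<phi> \<circ> (\<lambda>z. (of_int a * z + of_int b) / (of_int c * z + of_int d)))
               holomorphic_on slit_plane"
    using assms(1) by (rule holomorphic_on_compose_gen)
      (use side same_side_divide_in_slit_plane in blast)
  then have "(\<lambda>z. \<phi> ((of_int a * z + of_int b) / (of_int c * z + of_int d)))
               holomorphic_on slit_plane"
    by (simp add: o_def)
  then show ?thesis
    unfolding homog_def using slit by (intro holomorphic_intros) auto
qed

theorem theorem8p1:
  fixes n :: int and s lam :: complex and \<phi> :: "complex \<Rightarrow> complex"
  assumes "n \<ge> 1"
    and "lam \<in> {1, -1}"
    and "\<phi> holomorphic_on slit_plane"
    and "three_term_eq s lam \<phi>"
  shows "slash s \<phi> (T_prim n) holomorphic_on slit_plane \<and>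
         three_term_eq s lam (slash s \<phi> (T_prim n))"
proof
  let ?h = "homog s \<phi>"
  have entries: "a \<ge> 0" "b \<ge> 0" "c \<ge> 0" "d \<ge> 0" "a * d - b * c \<noteq> 0"
    if "(a, b, c, d) \<in> reduced_quads n" for a b c d
    using that assms(1) by (auto simp: reduced_quads_def prim_det_def)
  show "slash s \<phi> (T_prim n) holomorphic_on slit_plane"
    unfolding slash_T_prim[OF assms(1), abs_def] case_prod_unfold
    by (intro holomorphic_intros holomorphic_homog_linear assms(3)) (auto dest: entries)
  show "three_term_eq s lam (slash s \<phi> (T_prim n))"
    unfolding three_term_eq_def
  proof
    fix z assume z: "z \<in> slit_plane"
    then have "z \<noteq> 0" by auto
    define f where "f a b c d = ?h (of_int a * z + of_int b) (of_int c * z + of_int d)" for a b c d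
    have side: "same_side (of_int a * z + of_int b) (of_int c * z + of_int d)"
      if "prim_det n a b c d" "a \<ge> 0" "b \<ge> 0" "c \<ge> 0" "d \<ge> 0" for a b c d
      using that assms(1) by (intro same_side_nonneg_combination z) (auto simp: prim_det_def)
    have "(\<Sum>(a, b, c, d)\<in>reduced_quads n. f a b c d) =
        (\<Sum>(a, b, c, d)\<in>reduced_quads n. f a (a + b) c (c + d)) +
        (\<Sum>(a, b, c, d)\<in>reduced_quads n. f (a + b) b (c + d) d)"
      unfolding reduced_quads_def
    proof (rule sum_reduced_eq[OF prim_det_transvections])
      fix a b c d :: int
      assume "prim_det n a b c d" "a \<ge> 0" "b \<ge> 0" "c \<ge> 0" "d \<ge> 0"
      from homog_split[OF assms(2,4) side[OF this]]
      show "f a b c d = f (a + c) (b + d) c d + f a b (a + c) (b + d)"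
        by (simp add: f_def algebra_simps)
    qed (use finite_reduced finite_reduced_transpose in \<open>simp_all add: reduced_quads_def\<close>)
    also have "(\<Sum>(a, b, c, d)\<in>reduced_quads n. f a (a + b) c (c + d)) =
        (\<Sum>(a, b, c, d)\<in>reduced_quads n. ?h (of_int a * (z + 1) + of_int b) (of_int c * (z + 1) + of_int d))"
      by (simp add: f_def algebra_simps)
    also have "(\<Sum>(a, b, c, d)\<in>reduced_quads n. f (a + b) b (c + d) d) =
        (\<Sum>(a, b, c, d)\<in>reduced_quads n. lam * z powr (- 2 * s) *
           ?h (of_int a * (1 + 1 / z) + of_int b) (of_int c * (1 + 1 / z) + of_int d))"
    \<comment> \<open>Reindexing by conjugation with J is its own inverse; only the equality of
      summands, the fifth goal, needs an argument.\<close>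
    proof (rule sum.reindex_bij_witness[where i = "\<lambda>(a, b, c, d). (d, c, b, a)"
          and j = "\<lambda>(a, b, c, d). (d, c, b, a)"], goal_cases)
      case (5 x)
      obtain a b c d where x: "x = (a, b, c, d)" by (cases x)
      let ?u = "of_int (a + b) * z + of_int b" and ?v = "of_int (c + d) * z + of_int d"
      have abcd: "(a, b, c, d) \<in> reduced_quads n" using 5 x by simp
      have "prim_det n (a + b) b (c + d) d"
        using abcd by (simp add: reduced_quads_def prim_det_transvections)
      then have uv: "same_side ?u ?v"
        using entries[OF abcd] by (intro side) auto
      \<comment> \<open>Here \<open>z\<close> is written as a nonnegative combination so that the
        general lemma applies. Dividing both arguments of \<open>homog\<close> by \<open>z\<close>
        then produces the point \<open>1 + 1 / z\<close> and the factor
        \<open>z powr (- 2 * s)\<close>.\<close>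
      have "same_side ?u (of_int 1 * z + of_int 0)"
        using abcd by (intro same_side_nonneg_combination z) (auto simp: reduced_quads_def)
      then have "z powr (- 2 * s) * ?h (?v / z) (?u / z) = ?h ?v ?u"
        by (intro homog_divide) simp
      also have "?v / z = of_int d * (1 + 1 / z) + of_int c"
        using \<open>z \<noteq> 0\<close> by (simp add: field_simps)
      also have "?u / z = of_int b * (1 + 1 / z) + of_int a"
        using \<open>z \<noteq> 0\<close> by (simp add: field_simps)
      \<comment> \<open>The swap supplies \<open>lam\<close> and exchanges the rows; the division by
        \<open>z\<close> has exchanged the columns.\<close>
      finally show ?case
        using homog_swap[OF assms(2,4) uv] by (simp add: x f_def mult.assoc)
    qed (auto simp: reduced_quads_def prim_det_rotate)
    finally show "slash s \<phi> (T_prim n) z = slash s \<phi> (T_prim n) (z + 1) +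
        lam * z powr (- 2 * s) * slash s \<phi> (T_prim n) (1 + 1 / z)"
      by (simp add: slash_T_prim[OF assms(1)] f_def sum_distrib_left case_prod_unfold algebra_simps)
  qed
qed

end
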